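(* For a finite tree $T$ on $n = |V(T)|$ vertices, let $$s_{10}(T) = R(T) + \alpha(T) - n + 1 - \sqrt{n-1},$$ where $R(T) = \sum_{uv \in E(T)} \frac{1}{\sqrt{d_u d_v}}$ is the Randić index of $T$ and $\alpha(T)$ is the independence number of $T$. For each positive integer $b$, let $T(2,b)$ be the tree on $2b+1$ vertices with vertex set $\{u_1, \dots, u_b\} \cup \{v\} \cup \{w_1, \dots, w_b\}$ and edge set $\{u_1u_2, \dots, u_1u_b\} \cup \{u_1v, vw_1\} \cup \{w_1w_2, \dots, w_1w_b\}$. Then $$\lim_{b \to \infty} s_{10}(T(2,b)) = \infty.$$
   Context: Graphs are finite, simple and undirected; $V(G)$ and $E(G)$ denote the vertex and edge sets of $G$, an edge $\{u,v\}$ is written $uv$, and $d_v$ denotes the degree of the vertex $v$. The independence number $\alpha(G)$ is the maximum size of a set of pairwise nonadjacent vertices of $G$. In the definition of $T(2,b)$ the $2b+1$ named vertices are pairwise distinct; $T(2,b)$ is the tree obtained by joining the centers of two copies of the star on $b$ vertices to a new vertex $v$. *)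

theory Defs
  imports Complex_Main "HOL-Library.Ramsey"
begin

text \<open>
  Simple undirected graphs, with edges as two-element vertex sets. Then \<open>nsets\<close> and \<open>indep\<close>
  from \<^theory>\<open>HOL-Library.Ramsey\<close> apply directly.
\<close>

record 'a ugraph =
  verts :: "'a set"
  edges :: "'a set set"

definition simple_graph :: "'a ugraph \<Rightarrow> bool" where
  "simple_graph G \<longleftrightarrow> finite (verts G) \<and> edges G \<subseteq> nsets (verts G) 2"

definition connected_graph :: "'a ugraph \<Rightarrow> bool" where
  "connected_graph G \<longleftrightarrow> verts G \<noteq> {} \<and>
     (\<forall>x\<in>verts G. \<forall>y\<in>verts G. (x, y) \<in> {(p, q). {p, q} \<in> edges G}\<^sup>*)"

definition is_cycle :: "'a ugraph \<Rightarrow> 'a list \<Rightarrow> bool" where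
  "is_cycle G xs \<longleftrightarrow> length xs \<ge> 3 \<and> distinct xs \<and>
     (\<forall>i<length xs. {xs ! i, xs ! (Suc i mod length xs)} \<in> edges G)"

definition is_tree :: "'a ugraph \<Rightarrow> bool" where
  "is_tree G \<longleftrightarrow> simple_graph G \<and> connected_graph G \<and> (\<nexists>xs. is_cycle G xs)"

definition vdegree :: "'a ugraph \<Rightarrow> 'a \<Rightarrow> nat" where
  "vdegree G x = card {y \<in> verts G. {x, y} \<in> edges G}"

text \<open>For an edge \<open>e = {x, y}\<close>, the product over \<open>e\<close> is \<open>d\<^sub>x d\<^sub>y\<close>; each edge is summed once.\<close>

definition randic_index :: "'a ugraph \<Rightarrow> real" where
  "randic_index G = (\<Sum>e\<in>edges G. 1 / sqrt (\<Prod>x\<in>e. real (vdegree G x)))"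

definition independence_number :: "'a ugraph \<Rightarrow> nat" where
  "independence_number G = Max {card S | S. S \<subseteq> verts G \<and> indep S (edges G)}"

definition s10 :: "'a ugraph \<Rightarrow> real" where
  "s10 G = randic_index G + real (independence_number G) - real (card (verts G)) + 1
     - sqrt (real (card (verts G)) - 1)"

datatype vertex = U nat | V | W nat

text \<open>
  The tree \<open>T(2,b)\<close>, meaningful for \<open>b \<ge> 1\<close> only: for \<open>b = 0\<close> the edges at \<open>V\<close> leave the
  vertex set.
\<close>

definition T2 :: "nat \<Rightarrow> vertex ugraph" where
  "T2 b = \<lparr> verts = U ` {1..b} \<union> {V} \<union> W ` {1..b},
            edges = {{U 1, U i} | i. i \<in> {2..b}} \<union> {{U 1, V}, {V, W 1}}
                    \<union> {{W 1, W i} | i. i \<in> {2..b}} \<rparr>"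

lemma card_verts_T2: "card (verts (T2 b)) = 2 * b + 1"
proof -
  have "card (U ` {1..b} \<union> W ` {1..b}) = 2 * b"
    by (subst card_Un_disjoint) (auto simp: card_image inj_on_def)
  moreover have "verts (T2 b) = insert V (U ` {1..b} \<union> W ` {1..b})"
    by (auto simp: T2_def)
  ultimately show ?thesis
    by (subst \<open>verts (T2 b) = _\<close>, subst card_insert_disjoint) auto
qed

lemma simple_graph_T2:
  assumes "b \<ge> 1"
  shows "simple_graph (T2 b)"
  using assms by (auto simp: simple_graph_def T2_def nsets_def card_insert_if)

lemma connected_graph_T2:
  assumes "b \<ge> 1"
  shows "connected_graph (T2 b)"
proof -
  let ?R = "{(p, q). {p, q} \<in> edges (T2 b)}"
  have sym: "sym (?R\<^sup>*)"
    by (intro sym_rtrancl) (auto simp: sym_def insert_commute)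
  have U1: "(U 1, V) \<in> ?R\<^sup>*" and W1: "(W 1, V) \<in> ?R\<^sup>*"
    by (auto simp: T2_def insert_commute intro!: r_into_rtrancl)
  have U: "(U i, V) \<in> ?R\<^sup>*" if "i \<in> {1..b}" for i
  proof (cases "i = 1")
    case False
    then have "(U i, U 1) \<in> ?R"
      using that by (auto simp: T2_def insert_commute)
    then show ?thesis using U1 by (rule converse_rtrancl_into_rtrancl)
  qed (use U1 in simp)
  have W: "(W i, V) \<in> ?R\<^sup>*" if "i \<in> {1..b}" for i
  proof (cases "i = 1")
    case False
    then have "(W i, W 1) \<in> ?R"
      using that by (auto simp: T2_def insert_commute)
    then show ?thesis using W1 by (rule converse_rtrancl_into_rtrancl)
  qed (use W1 in simp)
  have toV: "(x, V) \<in> ?R\<^sup>*" if "x \<in> verts (T2 b)" for x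
    using that U W by (auto simp: T2_def)
  have "(x, y) \<in> ?R\<^sup>*" if "x \<in> verts (T2 b)" "y \<in> verts (T2 b)" for x y
    using toV[OF that(1)] symD[OF sym toV[OF that(2)]] by (rule rtrancl_trans)
  moreover have "verts (T2 b) \<noteq> {}"
    by (auto simp: T2_def)
  ultimately show ?thesis
    unfolding connected_graph_def by blast
qed

lemma is_cycle_two_neighbours:
  assumes "is_cycle G xs" "x \<in> set xs"
  shows "\<exists>y\<in>set xs. \<exists>z\<in>set xs. y \<noteq> z \<and> {x, y} \<in> edges G \<and> {x, z} \<in> edges G"
proof -
  let ?n = "length xs"
  have n: "?n \<ge> 3" and d: "distinct xs"
    and E: "\<And>i. i < ?n \<Longrightarrow> {xs ! i, xs ! (Suc i mod ?n)} \<in> edges G"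
    using assms(1) by (auto simp: is_cycle_def)
  obtain i where i: "i < ?n" "x = xs ! i"
    using assms(2) by (auto simp: in_set_conv_nth)
  define j where "j = (if i = 0 then ?n - 1 else i - 1)"
  have j: "j < ?n" "Suc j mod ?n = i"
    using i n by (auto simp: j_def)
  have k: "Suc i mod ?n < ?n"
    using n by (intro mod_less_divisor) auto
  have "j \<noteq> Suc i mod ?n"
    using i n by (auto simp: j_def mod_Suc)
  then have "xs ! j \<noteq> xs ! (Suc i mod ?n)"
    using d j k by (simp add: nth_eq_iff_index_eq)
  moreover have "{x, xs ! j} \<in> edges G"
    using E[OF j(1)] j(2) i(2) by (simp add: insert_commute)
  moreover have "{x, xs ! (Suc i mod ?n)} \<in> edges G"
    using E[OF i(1)] i(2) by simp
  ultimately show ?thesis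
    using j k nth_mem by blast
qed

lemma is_tree_T2:
  assumes "b \<ge> 1"
  shows "is_tree (T2 b)"
proof -
  have False if c: "is_cycle (T2 b) xs" for xs
  proof -
    note nb = is_cycle_two_neighbours[OF c]
    have leafU: "U i \<notin> set xs" if "i \<noteq> 1" for i
      using nb[of "U i"] that by (auto simp: T2_def doubleton_eq_iff)
    have leafW: "W i \<notin> set xs" if "i \<noteq> 1" for i
      using nb[of "W i"] that by (auto simp: T2_def doubleton_eq_iff)
    have U1: "U 1 \<notin> set xs"
      using nb[of "U 1"] leafU by (auto simp: T2_def doubleton_eq_iff)
    have W1: "W 1 \<notin> set xs"
      using nb[of "W 1"] leafW by (auto simp: T2_def doubleton_eq_iff)
    have "set xs \<subseteq> {V}"
    proof
      fix x assume x: "x \<in> set xs"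
      show "x \<in> {V}"
      proof (cases x)
        case (U i)
        then show ?thesis using x leafU U1 by metis
      next
        case (W i)
        then show ?thesis using x leafW W1 by metis
      qed simp
    qed
    then have "card (set xs) \<le> 1"
      using card_mono[of "{V}" "set xs"] by simp
    then show False
      using c by (simp add: is_cycle_def distinct_card)
  qed
  then show ?thesis
    using assms simple_graph_T2 connected_graph_T2 by (auto simp: is_tree_def)
qed

end

theory Submission
  imports Defs "HOL-Real_Asymp.Real_Asymp"
begin

text \<open>
  The $2b - 2$ leaf edges each contribute $1 / \sqrt b$ to the Randic index, and the leaves together
  with \<open>V\<close> are independent, so $s_{10}(T(2,b)) \ge 2(b-1)/\sqrt b - 1 - \sqrt{2b}$. As
  $2 > \sqrt 2$, the right-hand side grows like $(2 - \sqrt 2) \sqrt b$.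
\<close>

lemma vdegree_T2_center:
  assumes "b \<ge> 1"
  shows "vdegree (T2 b) (U 1) = b" "vdegree (T2 b) (W 1) = b"
proof -
  have U: "{y \<in> verts (T2 b). {U 1, y} \<in> edges (T2 b)} = insert V (U ` {2..b})"
    and W: "{y \<in> verts (T2 b). {W 1, y} \<in> edges (T2 b)} = insert V (W ` {2..b})"
    using assms by (auto simp: T2_def doubleton_eq_iff)
  show "vdegree (T2 b) (U 1) = b" "vdegree (T2 b) (W 1) = b"
    unfolding vdegree_def U W
    using assms by (subst card_insert_disjoint; auto simp: card_image inj_on_def)+
qed

lemma vdegree_T2_leaf:
  assumes "i \<in> {2..b}"
  shows "vdegree (T2 b) (U i) = 1" "vdegree (T2 b) (W i) = 1"
proof -
  have U: "{y \<in> verts (T2 b). {U i, y} \<in> edges (T2 b)} = {U 1}"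
    and W: "{y \<in> verts (T2 b). {W i, y} \<in> edges (T2 b)} = {W 1}"
    using assms by (auto simp: T2_def doubleton_eq_iff)
  show "vdegree (T2 b) (U i) = 1" "vdegree (T2 b) (W i) = 1"
    unfolding vdegree_def U W by simp_all
qed

lemma finite_edges_T2: "finite (edges (T2 b))"
  by (simp add: T2_def Setcompr_eq_image)

lemma randic_index_T2_ge:
  assumes "b \<ge> 1"
  shows "randic_index (T2 b) \<ge> 2 * (real b - 1) / sqrt (real b)"
proof -
  let ?f = "\<lambda>e. 1 / sqrt (\<Prod>x\<in>e. real (vdegree (T2 b) x))"
  let ?A = "(\<lambda>i. {U 1, U i}) ` {2..b}" and ?B = "(\<lambda>i. {W 1, W i}) ` {2..b}"
  \<comment> \<open>Since \<open>i\<close> starts at 2, the two ends of a leaf edge differ, so the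
    product over the set \<open>e\<close> has both factors, \<open>b\<close> and 1.\<close>
  have leaf_edge: "?f e = 1 / sqrt (real b)" if "e \<in> ?A \<union> ?B" for e
    using that assms vdegree_T2_center[of b] vdegree_T2_leaf[of _ b] by auto
  have "card (?A \<union> ?B) = card ?A + card ?B"
    by (rule card_Un_disjoint) (auto simp: doubleton_eq_iff)
  also have "\<dots> = 2 * (b - 1)"
    by (subst (1 2) card_image) (auto simp: inj_on_def doubleton_eq_iff)
  finally have "(\<Sum>e\<in>?A \<union> ?B. ?f e) = 2 * (real b - 1) / sqrt (real b)"
    using leaf_edge assms by (simp add: of_nat_diff)
  \<comment> \<open>The two edges at \<open>V\<close> are dropped: their terms are nonnegative, and
    they tend to 0 as \<open>b\<close> grows.\<close>
  moreover have "(\<Sum>e\<in>?A \<union> ?B. ?f e) \<le> (\<Sum>e\<in>edges (T2 b). ?f e)"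
    by (rule sum_mono2[OF finite_edges_T2]) (auto simp: T2_def prod_nonneg)
  ultimately show ?thesis
    by (simp add: randic_index_def)
qed

text \<open>Finiteness of the vertex set bounds the family of cardinalities, so \<open>Max\<close>
  is a genuine maximum.\<close>

lemma independence_number_ge:
  assumes "finite (verts G)" "S \<subseteq> verts G" "indep S (edges G)"
  shows "card S \<le> independence_number G"
  unfolding independence_number_def
proof (rule Max_ge)
  have "{card S | S. S \<subseteq> verts G \<and> indep S (edges G)} \<subseteq> card ` Pow (verts G)"
    by auto
  then show "finite {card S | S. S \<subseteq> verts G \<and> indep S (edges G)}"
    by (rule finite_subset) (simp add: assms(1))
qed (use assms in auto)

text \<open>Every edge contains \<open>U 1\<close> or \<open>W 1\<close>, so removing these two
  vertices leaves an independent set.\<close>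

lemma independence_number_T2_ge:
  assumes "b \<ge> 1"
  shows "2 * b - 1 \<le> independence_number (T2 b)"
proof -
  let ?S = "insert V (U ` {2..b} \<union> W ` {2..b})"
  have "card (U ` {2..b} \<union> W ` {2..b}) = 2 * (b - 1)"
    by (subst card_Un_disjoint) (auto simp: card_image inj_on_def)
  then have "card ?S = 2 * b - 1"
    using assms by (subst card_insert_disjoint) auto
  moreover have "card ?S \<le> independence_number (T2 b)"
    by (rule independence_number_ge) (auto simp: T2_def indep_def doubleton_eq_iff)
  ultimately show ?thesis by simp
qed

lemma s10_T2_ge:
  assumes "b \<ge> 1"
  shows "s10 (T2 b) \<ge> 2 * (real b - 1) / sqrt (real b) - 1 - 3 / 2 * sqrt (real b)"
proof -
  have "real (independence_number (T2 b)) \<ge> 2 * real b - 1"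
    using independence_number_T2_ge[OF assms] by linarith
  \<comment> \<open>The constant 3/2 is a rational between \<open>sqrt 2\<close> and 2: it bounds
    the root term, as 2 \<le> 9/4, yet stays below the coefficient 2 from the leaf edges.\<close>
  moreover have "sqrt (2 * real b) \<le> 3 / 2 * sqrt (real b)"
    by (rule real_le_lsqrt) (simp_all add: power_mult_distrib power2_eq_square)
  ultimately show ?thesis
    using randic_index_T2_ge[OF assms] by (simp add: s10_def card_verts_T2)
qed

theorem theorem4:
  shows "filterlim (\<lambda>b::nat. s10 (T2 b)) at_top sequentially"
proof (rule filterlim_at_top_mono)
  show "filterlim (\<lambda>b. 2 * (real b - 1) / sqrt (real b) - 1 - 3 / 2 * sqrt (real b)) at_top sequentially"
    \<comment> \<open>The bound equals \<open>sqrt b / 2 - 1 - 2 / sqrt b\<close> for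
      \<open>b \<ge> 1\<close>.\<close>
    by real_asymp
  show "\<forall>\<^sub>F b in sequentially. 2 * (real b - 1) / sqrt (real b) - 1 - 3 / 2 * sqrt (real b) \<le> s10 (T2 b)"
    using eventually_ge_at_top[of 1] by eventually_elim (rule s10_T2_ge)
qed

end
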